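(* Let $K$ be a field, let $\mathcal{H}$ be a complete $s$-uniform $t$-partite hypergraph with $2\leq s\leq t$ on vertex set $\{x_1,\ldots,x_n\}$, and $R=K[x_1,\ldots,x_n]$. Then $R/I(\mathcal{H})$ is almost complete intersection if and only if one of the following holds: (a) $\mathcal{H}$ is the $3$-cycle $C_3$ (the complete graph on three vertices); or (b) $\mathcal{H}$ is the hypergraph on $t+1$ vertices $v_1,\ldots,v_{t+1}$ whose edges are exactly $\{v_1,\ldots,v_{t-1},v_t\}$ and $\{v_1,\ldots,v_{t-1},v_{t+1}\}$.
   Context: A complete $s$-uniform $t$-partite hypergraph has vertex set partitioned into nonempty sides $V_1,\ldots,V_t$, and its edges are exactly all $s$-element vertex subsets consisting of one vertex from each of $s$ distinct sides. The edge ideal is $I(\mathcal{H})=(\prod_{x\in e}x: e\in\mathcal{H})$. $R/I$ is almost complete intersection if $\mu(I)=\mathrm{ht}(I)+1$, where $\mu(I)$ is the number of minimal generators of $I$. *)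

theory Defs
  imports Main "HOL-Library.Poly_Mapping" "HOL-Library.Extended_Nat"
begin

text \<open>Multivariate polynomial ring K[x_v : v in V] for a finite type V of vertices:
  polynomials are finitely supported maps from monomials (exponent vectors 'v =>0 nat) to K.\<close>

type_synonym ('v, 'k) mpoly = "('v \<Rightarrow>\<^sub>0 nat) \<Rightarrow>\<^sub>0 'k"

definition is_ideal :: "'a::comm_ring_1 set \<Rightarrow> bool" where
  "is_ideal I \<longleftrightarrow> 0 \<in> I \<and> (\<forall>a\<in>I. \<forall>b\<in>I. a + b \<in> I) \<and> (\<forall>r. \<forall>a\<in>I. r * a \<in> I)"

definition gen_ideal :: "'a::comm_ring_1 set \<Rightarrow> 'a set" where
  "gen_ideal S = \<Inter>{I. is_ideal I \<and> S \<subseteq> I}"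

definition prime_ideal :: "'a::comm_ring_1 set \<Rightarrow> bool" where
  "prime_ideal P \<longleftrightarrow> is_ideal P \<and> P \<noteq> UNIV \<and> (\<forall>a b. a * b \<in> P \<longrightarrow> a \<in> P \<or> b \<in> P)"

definition prime_height :: "'a::comm_ring_1 set \<Rightarrow> enat" where
  "prime_height P = Sup {enat n | n. \<exists>c :: nat \<Rightarrow> 'a set.
      (\<forall>i\<le>n. prime_ideal (c i)) \<and> (\<forall>i<n. c i \<subset> c (Suc i)) \<and> c n = P}"

definition ideal_height :: "'a::comm_ring_1 set \<Rightarrow> enat" where
  "ideal_height I = Inf {prime_height P | P. prime_ideal P \<and> I \<subseteq> P}"

definition num_gens :: "'a::comm_ring_1 set \<Rightarrow> enat" where
  "num_gens I = Inf {enat (card G) | G. finite G \<and> gen_ideal G = I}"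

definition almost_complete_intersection :: "'a::comm_ring_1 set \<Rightarrow> bool" where
  "almost_complete_intersection I \<longleftrightarrow> num_gens I = ideal_height I + 1"

definition edge_monomial :: "'v set \<Rightarrow> ('v, 'k::comm_ring_1) mpoly" where
  "edge_monomial e = Poly_Mapping.single (\<Sum>x\<in>e. Poly_Mapping.single x (1::nat)) 1"

definition edge_ideal :: "'v set set \<Rightarrow> ('v, 'k::comm_ring_1) mpoly set" where
  "edge_ideal H = gen_ideal (edge_monomial ` H)"

text \<open>Complete s-uniform t-partite hypergraph on vertex set UNIV: the side map
  assigns each vertex one of t nonempty sides 0..t-1 (surjectively); edges are exactly the
  s-element sets meeting s distinct sides (one vertex per side).\<close>
definition complete_uniform_multipartite :: "nat \<Rightarrow> nat \<Rightarrow> 'v set set \<Rightarrow> bool" where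
  "complete_uniform_multipartite s t H \<longleftrightarrow>
     (\<exists>side :: 'v \<Rightarrow> nat. side ` UNIV = {..<t} \<and>
        H = {e. finite e \<and> card e = s \<and> inj_on side e})"

end

theory Submission
  imports Defs "HOL-Library.FuncSet"
begin

text \<open>Both invariants are combinatorial. Since the edges form an antichain, the edge monomials are
  a minimal generating set, so \<open>\<mu>(I)\<close> is the number of edges. A prime containing \<open>I\<close> contains a
  variable of every edge, hence the ideal generated by a vertex cover, so the height of \<open>I\<close> is the
  least size of a vertex cover. For the latter one needs that \<open>(x\<^sub>v | v \<in> C)\<close> has height at most
  \<open>|C|\<close>; instead of Krull's theorem this uses a dimension count for the polynomials of bounded
  degree. Finally, if the edges outnumber a minimum vertex cover by exactly one, then no three edges
  share a vertex and no two disjoint pairs of edges each share a vertex, and this leaves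
  only the two listed hypergraphs.\<close>

abbreviation lookup where "lookup \<equiv> Poly_Mapping.lookup"
abbreviation keys where "keys \<equiv> Poly_Mapping.keys"
abbreviation single where "single \<equiv> Poly_Mapping.single"

subsection \<open>Ideals\<close>

lemma is_ideal_zero: "is_ideal I \<Longrightarrow> 0 \<in> I"
  and is_ideal_add: "is_ideal I \<Longrightarrow> a \<in> I \<Longrightarrow> b \<in> I \<Longrightarrow> a + b \<in> I"
  and is_ideal_mult: "is_ideal I \<Longrightarrow> a \<in> I \<Longrightarrow> r * a \<in> I"
  by (auto simp: is_ideal_def)

lemma is_ideal_mult_right: "is_ideal I \<Longrightarrow> a \<in> I \<Longrightarrow> a * r \<in> I"
  by (metis is_ideal_mult mult.commute)

lemma is_ideal_diff: "is_ideal I \<Longrightarrow> a \<in> I \<Longrightarrow> b \<in> I \<Longrightarrow> a - b \<in> I"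
  using is_ideal_add[of I a "-1 * b"] is_ideal_mult[of I b "-1"] by simp

lemma is_ideal_sum: "is_ideal I \<Longrightarrow> (\<And>x. x \<in> A \<Longrightarrow> f x \<in> I) \<Longrightarrow> sum f A \<in> I"
  by (induction A rule: infinite_finite_induct) (auto intro: is_ideal_zero is_ideal_add)

lemma gen_ideal_superset: "S \<subseteq> gen_ideal S"
  by (auto simp: gen_ideal_def)

lemma gen_ideal_minimal: "is_ideal I \<Longrightarrow> S \<subseteq> I \<Longrightarrow> gen_ideal S \<subseteq> I"
  by (auto simp: gen_ideal_def)

lemma is_ideal_gen_ideal: "is_ideal (gen_ideal S)"
  by (auto simp: gen_ideal_def is_ideal_def)

lemma prime_ideal_is_ideal: "prime_ideal P \<Longrightarrow> is_ideal P"
  by (simp add: prime_ideal_def)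

lemma prime_ideal_multD: "prime_ideal P \<Longrightarrow> a * b \<in> P \<Longrightarrow> a \<in> P \<or> b \<in> P"
  by (auto simp: prime_ideal_def)

lemma prime_ideal_one: "prime_ideal P \<Longrightarrow> 1 \<notin> P"
  using is_ideal_mult[of P 1] by (auto simp: prime_ideal_def)

lemma prime_ideal_powerD: "prime_ideal P \<Longrightarrow> a ^ n \<in> P \<Longrightarrow> a \<in> P"
proof (induction n)
  case (Suc n)
  then show ?case using prime_ideal_multD[of P a "a ^ n"] by auto
qed (simp add: prime_ideal_one)

lemma prime_ideal_prodD:
  "prime_ideal P \<Longrightarrow> finite A \<Longrightarrow> prod f A \<in> P \<Longrightarrow> \<exists>x\<in>A. f x \<in> P"
proof (induction A rule: infinite_finite_induct)
  case (insert x F)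
  then show ?case using prime_ideal_multD[of P "f x" "prod f F"] by auto
qed (auto simp: prime_ideal_one)

subsection \<open>Prime ideals generated by variables\<close>

text \<open>Exponents of a product are sums of exponents of the factors, so a set of exponents
  closed under adding arbitrary exponents makes the support condition stable under multiplication.
  This serves for ideals of variables and for edge ideals alike.\<close>

lemma is_ideal_monomial_ideal:
  fixes S :: "('v \<Rightarrow>\<^sub>0 nat) set"
  assumes S: "\<And>k m. m \<in> S \<Longrightarrow> k + m \<in> S"
  shows "is_ideal {p :: ('v, 'k::comm_ring_1) mpoly. keys p \<subseteq> S}"
proof -
  have "keys (r * p) \<subseteq> S" if "keys p \<subseteq> S" for r p :: "('v, 'k) mpoly"
    using that keys_mult[of r p] S by fastforce
  moreover have "keys (p + q) \<subseteq> S" if "keys p \<subseteq> S" "keys q \<subseteq> S" for p q :: "('v, 'k) mpoly"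
    using that Poly_Mapping.keys_add[of p q] by blast
  ultimately show ?thesis unfolding is_ideal_def by simp
qed

text \<open>The ideal generated by the variables \<open>x_v\<close> with \<open>v \<in> C\<close>,
  described by supports so that non-membership can be read off from a single monomial.\<close>

definition var_ideal :: "'v set \<Rightarrow> ('v, 'k::comm_ring_1) mpoly set" where
  "var_ideal C = {p. keys p \<subseteq> {m. \<exists>v\<in>C. lookup m v \<noteq> 0}}"

lemma var_idealD: "p \<in> var_ideal C \<Longrightarrow> m \<in> keys p \<Longrightarrow> \<exists>v\<in>C. lookup m v \<noteq> 0"
  by (auto simp: var_ideal_def)

lemma is_ideal_var_ideal: "is_ideal (var_ideal C)"
  unfolding var_ideal_def by (rule is_ideal_monomial_ideal) (auto simp: lookup_add)

lemma one_notin_var_ideal: "1 \<notin> var_ideal C"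
  by (simp add: var_ideal_def)

lemma var_ideal_mono: "C \<subseteq> D \<Longrightarrow> var_ideal C \<subseteq> var_ideal D"
  by (fastforce simp: var_ideal_def)

lemma var_mem_var_ideal_iff:
  "single (single v 1) 1 \<in> (var_ideal C :: ('v, 'k::comm_ring_1) mpoly set) \<longleftrightarrow> v \<in> C"
  by (auto simp: var_ideal_def lookup_single when_def)

text \<open>The pair is found by minimising one coordinate after the other.\<close>

lemma unique_sum_pair:
  fixes A B :: "('v::finite \<Rightarrow> nat) set"
  assumes "A \<noteq> {}" "B \<noteq> {}"
  shows "\<exists>a\<in>A. \<exists>b\<in>B. \<forall>a'\<in>A. \<forall>b'\<in>B. (\<forall>v. a' v + b' v = a v + b v) \<longrightarrow> a' = a \<and> b' = b"
proof -
  \<comment> \<open>\<open>closed\<close> makes \<open>A' \<times> B'\<close> a face of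
    \<open>A \<times> B\<close>: every pair with the same sum as a pair of the face lies in the
    face.\<close>
  define closed where "closed A' B' \<longleftrightarrow>
    (\<forall>a\<in>A'. \<forall>b\<in>B'. \<forall>a'\<in>A. \<forall>b'\<in>B. (\<forall>v. a' v + b' v = a v + b v) \<longrightarrow> a' \<in> A' \<and> b' \<in> B')" for A' B'
  define agree where "agree S X \<longleftrightarrow> (\<forall>v\<in>S. \<forall>a\<in>X. \<forall>a'\<in>X. a v = a' v)" for S and X :: "('v \<Rightarrow> nat) set"
  have least: "\<exists>x0\<in>X. \<forall>x\<in>X. x0 u \<le> x u" if "X \<noteq> {}" for X :: "('v \<Rightarrow> nat) set" and u
    using that ex_has_least_nat[of "\<lambda>x. x \<in> X" _ "\<lambda>x. x u"] by blast
  have "\<exists>A' B'. A' \<noteq> {} \<and> B' \<noteq> {} \<and> A' \<subseteq> A \<and> B' \<subseteq> B \<and> agree S A' \<and> agree S B' \<and> closed A' B'"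
    if "finite S" for S
    using that
  proof (induction S)
    case empty
    have "agree {} A" "agree {} B" "closed A B" by (auto simp: agree_def closed_def)
    then show ?case using assms by blast
  next
    case (insert u S)
    then obtain A' B' where ne: "A' \<noteq> {}" "B' \<noteq> {}" and sub: "A' \<subseteq> A" "B' \<subseteq> B"
      and ag: "agree S A'" "agree S B'" and cl: "closed A' B'" by blast
    obtain a0 where a0: "a0 \<in> A'" "\<And>a. a \<in> A' \<Longrightarrow> a0 u \<le> a u" using least[OF ne(1)] by blast
    obtain b0 where b0: "b0 \<in> B'" "\<And>b. b \<in> B' \<Longrightarrow> b0 u \<le> b u" using least[OF ne(2)] by blast
    define A2 B2 where "A2 = {a \<in> A'. a u = a0 u}" and "B2 = {b \<in> B'. b u = b0 u}"
    \<comment> \<open>\<open>a\<close> and \<open>b\<close> are minimal at \<open>u\<close>, so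
      \<open>a'\<close> and \<open>b'\<close>, which lie in \<open>A'\<close> and \<open>B'\<close>,
      can have the same sum at \<open>u\<close> only if both are minimal too.\<close>
    have "a' \<in> A2 \<and> b' \<in> B2" if "a \<in> A2" "b \<in> B2" "a' \<in> A" "b' \<in> B" "\<forall>v. a' v + b' v = a v + b v" for a b a' b'
    proof -
      have "a \<in> A'" "b \<in> B'" using that by (auto simp: A2_def B2_def)
      then have *: "a' \<in> A'" "b' \<in> B'" using cl that(3-5) unfolding closed_def by blast+
      have "a' u + b' u = a0 u + b0 u" using that by (auto simp: A2_def B2_def)
      then show ?thesis using * a0(2)[OF *(1)] b0(2)[OF *(2)] by (auto simp: A2_def B2_def)
    qed
    then have "closed A2 B2" unfolding closed_def by blast
    moreover have "agree (insert u S) A2" "agree (insert u S) B2"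
      using ag by (auto simp: agree_def A2_def B2_def)
    moreover have "A2 \<noteq> {}" "B2 \<noteq> {}" "A2 \<subseteq> A" "B2 \<subseteq> B"
      using a0(1) b0(1) sub by (auto simp: A2_def B2_def)
    ultimately show ?case by blast
  qed
  from this[OF finite_UNIV] obtain A' B' where ne: "A' \<noteq> {}" "B' \<noteq> {}" and sub: "A' \<subseteq> A" "B' \<subseteq> B"
    and ag: "agree UNIV A'" "agree UNIV B'" and cl: "closed A' B'" by blast
  obtain a b where ab: "a \<in> A'" "b \<in> B'" using ne by blast
  have "a' = a \<and> b' = b" if "a' \<in> A" "b' \<in> B" "\<forall>v. a' v + b' v = a v + b v" for a' b'
  proof -
    have "a' \<in> A'" "b' \<in> B'" using cl that ab unfolding closed_def by blast+
    then show ?thesis using ag ab by (auto simp: agree_def fun_eq_iff)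
  qed
  then show ?thesis using ab sub by blast
qed

text \<open>Only one pair of monomials can contribute at \<open>a + b\<close>, so nothing cancels.
  If \<open>a\<close> or \<open>b\<close> lies outside the support, both sides vanish; this case
  occurs below for multipliers without constant term.\<close>

lemma lookup_mult_unique_pair:
  fixes p q :: "('v, 'k::comm_ring_1) mpoly"
  assumes "\<And>a' b'. a' \<in> keys p \<Longrightarrow> b' \<in> keys q \<Longrightarrow> a' + b' = a + b \<Longrightarrow> a' = a \<and> b' = b"
  shows "lookup (p * q) (a + b) = lookup p a * lookup q b"
proof -
  have 1: "(lookup q k2 when a + b = k1 + k2) = 0 \<or> k1 = a \<and> k2 = b" if "lookup p k1 \<noteq> 0" for k1 k2
    using assms[of k1 k2] that by (auto simp: in_keys_iff when_def)
  have 2: "Sum_any (\<lambda>k2. lookup q k2 when a + b = k1 + k2) = (lookup q b when k1 = a)" if "lookup p k1 \<noteq> 0" for k1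
  proof -
    have "(lookup q k2 when a + b = k1 + k2) = ((lookup q b when k1 = a) when k2 = b)" for k2
      using 1[OF that, of k2] by (auto simp: when_def)
    then show ?thesis by simp
  qed
  have "lookup p k1 * Sum_any (\<lambda>k2. lookup q k2 when a + b = k1 + k2) = (lookup p a * lookup q b when k1 = a)" for k1
    using 2[of k1] by (cases "lookup p k1 = 0") (auto simp: when_def)
  then show ?thesis by (simp add: lookup_mult)
qed

text \<open>If neither factor is in the ideal, both have monomials free of the variables in
  \<open>C\<close>. A uniquely represented sum of two such exponents gives a monomial that survives
  in the product and is again free of \<open>C\<close>.\<close>

lemma prime_ideal_var_ideal:
  "prime_ideal (var_ideal C :: ('v::finite, 'k::field) mpoly set)"
  unfolding prime_ideal_def
proof (intro conjI allI impI)
  fix p q :: "('v, 'k) mpoly"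
  assume pq: "p * q \<in> var_ideal C"
  define off where "off m \<longleftrightarrow> (\<forall>v\<in>C. lookup m v = 0)" for m :: "'v \<Rightarrow>\<^sub>0 nat"
  show "p \<in> var_ideal C \<or> q \<in> var_ideal C"
  proof (rule ccontr)
    assume "\<not> ?thesis"
    then have "lookup ` {m\<in>keys p. off m} \<noteq> {}" "lookup ` {m\<in>keys q. off m} \<noteq> {}"
      by (auto simp: var_ideal_def off_def)
    from unique_sum_pair[OF this] obtain a b where ab: "a \<in> keys p" "off a" "b \<in> keys q" "off b"
      and u0: "\<forall>a'\<in>lookup ` {m\<in>keys p. off m}. \<forall>b'\<in>lookup ` {m\<in>keys q. off m}.
        (\<forall>v. a' v + b' v = lookup a v + lookup b v) \<longrightarrow> a' = lookup a \<and> b' = lookup b"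
      by blast
    have u: "a' = a \<and> b' = b"
      if "a' \<in> keys p" "off a'" "b' \<in> keys q" "off b'" "a' + b' = a + b" for a' b'
    proof -
      have "lookup a' v + lookup b' v = lookup a v + lookup b v" for v
        using arg_cong[OF that(5), of "\<lambda>m. lookup m v"] by (simp add: lookup_add)
      then have "lookup a' = lookup a \<and> lookup b' = lookup b" using u0 that(1-4) by blast
      then show ?thesis by simp
    qed
    have offs: "off (a + b)" using ab by (simp add: off_def lookup_add)
    have "lookup (p * q) (a + b) = lookup p a * lookup q b"
    \<comment> \<open>Exponents are natural numbers, so a sum that vanishes on \<open>C\<close> has
      summands that vanish on \<open>C\<close>; uniqueness among such keys is therefore uniqueness
      among all keys.\<close>
    proof (rule lookup_mult_unique_pair)
      fix a' b' assume *: "a' \<in> keys p" "b' \<in> keys q" "a' + b' = a + b"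
      then have "off (a' + b')" using offs by simp
      then have "off a'" "off b'" by (auto simp: off_def lookup_add)
      then show "a' = a \<and> b' = b" using u * by blast
    qed
    then have "a + b \<in> keys (p * q)" using ab by (simp add: in_keys_iff)
    then have "\<exists>v\<in>C. lookup (a + b) v \<noteq> 0" by (rule var_idealD[OF pq])
    then show False using offs by (simp add: off_def)
  qed
next
  show "var_ideal C \<noteq> (UNIV :: ('v, 'k) mpoly set)" using one_notin_var_ideal by blast
qed (rule is_ideal_var_ideal)

lemma single_sum_exponents:
  "finite A \<Longrightarrow> single (sum f A) (1::'k::comm_ring_1) = (\<Prod>x\<in>A. single (f x) 1)"
proof (induction A rule: finite_induct)
  case (insert x F)
  then show ?case using mult_single[of "f x" 1 "sum f F" "1::'k"] by simp
qed simp

lemma poly_mapping_sum_monomials: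
  "(\<Sum>m\<in>keys p. single m (lookup p m)) = (p :: 'a \<Rightarrow>\<^sub>0 'b::comm_monoid_add)"
proof (intro poly_mapping_eqI)
  fix n
  have "lookup (\<Sum>m\<in>keys p. single m (lookup p m)) n = (\<Sum>m\<in>keys p. if m = n then lookup p n else 0)"
    by (auto simp: lookup_sum lookup_single when_def intro!: sum.cong)
  then show "lookup (\<Sum>m\<in>keys p. single m (lookup p m)) n = lookup p n"
    by (simp add: in_keys_iff)
qed

lemma var_ideal_subset:
  fixes P :: "('v::finite, 'k::comm_ring_1) mpoly set"
  assumes P: "is_ideal P" and C: "\<And>v. v \<in> C \<Longrightarrow> single (single v 1) 1 \<in> P"
  shows "var_ideal C \<subseteq> P"
proof
  fix p :: "('v, 'k) mpoly" assume p: "p \<in> var_ideal C"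
  have "single m (lookup p m) \<in> P" if "m \<in> keys p" for m
  proof -
    obtain v where v: "v \<in> C" "lookup m v \<noteq> 0"
      using var_idealD[OF p \<open>m \<in> keys p\<close>] by blast
    \<comment> \<open>Subtraction of exponents is truncated, but here it is exact because
      \<open>v\<close> occurs in \<open>m\<close>.\<close>
    have "(m - single v 1) + single v 1 = m"
      using v by (intro poly_mapping_eqI) (auto simp: lookup_add lookup_minus lookup_single when_def)
    then have "single m (lookup p m) = single (m - single v 1) (lookup p m) * single (single v 1) 1"
      using mult_single[of "m - single v 1" "lookup p m" "single v 1" 1] by simp
    then show ?thesis using C[OF v(1)] is_ideal_mult[OF P] by simp
  qed
  then have "(\<Sum>m\<in>keys p. single m (lookup p m)) \<in> P" by (intro is_ideal_sum[OF P])
  then show "p \<in> P" by (simp add: poly_mapping_sum_monomials)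
qed

subsection \<open>Heights of prime ideals generated by variables\<close>

text \<open>The exchange bound for an indexed family instead of a set, so that distinctness of the
  members need not be shown separately when counting.\<close>

lemma (in vector_space) card_le_if_indep_family:
  assumes I: "finite I" and T: "finite T" and sp: "\<And>i. i \<in> I \<Longrightarrow> g i \<in> span T"
    and indep: "\<And>q i. (\<Sum>i\<in>I. scale (q i) (g i)) = 0 \<Longrightarrow> i \<in> I \<Longrightarrow> q i = 0"
  shows "card I \<le> card T"
proof -
  have inj: "inj_on g I"
  proof (rule inj_onI, rule ccontr)
    fix i j assume ij: "i \<in> I" "j \<in> I" "g i = g j" "i \<noteq> j"
    \<comment> \<open>A repetition would be a relation with coefficients 1 and -1.\<close>
    let ?q = "\<lambda>k. if k = i then 1 else if k = j then -1 else 0"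
    have "(\<Sum>k\<in>I. scale (?q k) (g k)) = (\<Sum>k\<in>{i, j}. scale (?q k) (g k))"
      using ij I by (intro sum.mono_neutral_right) auto
    also have "\<dots> = 0" using ij by simp
    finally show False using indep[of ?q i] ij(1) by simp
  qed
  have "independent (g ` I)"
  proof (rule independent_if_scalars_zero)
    fix f x assume "(\<Sum>x\<in>g ` I. scale (f x) x) = 0" "x \<in> g ` I"
    then show "f x = 0" using indep[of "\<lambda>i. f (g i)"] inj by (auto simp: sum.reindex)
  qed (use I in simp)
  then have "card (g ` I) \<le> card T"
    using independent_span_bound[OF T] sp by blast
  then show ?thesis using inj by (simp add: card_image)
qed

text \<open>The field acts through constant polynomials; both counting arguments, for heights and
  for generators, take place in this vector space.\<close>

interpretation mpoly_space: vector_space "\<lambda>(c::'k::field) (p::('v, 'k) mpoly). single 0 c * p"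
proof
  show "single 0 c * (single 0 d * p) = single 0 (c * d) * p" for c d and p :: "('v, 'k) mpoly"
    by (simp add: mult_single flip: mult.assoc)
qed (simp_all add: distrib_left distrib_right single_add)

text \<open>The recursion removes \<open>a 0\<close> and shifts the rest, in step with the induction
  below, which removes the bottom prime of a chain.\<close>

fun power_prod :: "(nat \<Rightarrow> 'a::comm_monoid_mult) \<Rightarrow> nat list \<Rightarrow> 'a" where
  "power_prod a [] = 1"
| "power_prod a (m # l) = a 0 ^ m * power_prod (\<lambda>i. a (Suc i)) l"

text \<open>Modulo \<open>c 0\<close>, a relation between the power products of the \<open>a i\<close> with coefficients outside
  \<open>c n\<close> is impossible: cancel the smallest occurring power of \<open>a 0\<close>, reduce modulo \<open>c 1\<close> and
  repeat.\<close>

lemma prime_chain_relation_trivial: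
  fixes a :: "nat \<Rightarrow> 'a::comm_ring_1"
  assumes "\<And>i. i \<le> n \<Longrightarrow> prime_ideal (c i)"
    and "\<And>i. i < n \<Longrightarrow> c i \<subseteq> c (Suc i)"
    and "\<And>i. i < n \<Longrightarrow> a i \<in> c (Suc i) - c i"
    and "\<And>l. set l \<subseteq> {..d} \<Longrightarrow> length l = n \<Longrightarrow> s l \<in> c n \<Longrightarrow> s l = 0"
    and "(\<Sum>l | set l \<subseteq> {..d} \<and> length l = n. s l * power_prod a l) \<in> c 0"
    and "set l \<subseteq> {..d}" "length l = n"
  shows "s l = 0"
  using assms
proof (induction n arbitrary: c a s l)
  case 0
  \<comment> \<open>A chain of length 0 leaves only the empty list, and the relation says that
    \<open>s []\<close> lies in \<open>c 0\<close>, which is \<open>c n\<close>.\<close>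
  have "{l. set l \<subseteq> {..d} \<and> length l = 0} = {[]}" by auto
  then show ?case using 0 by auto
next
  case (Suc n)
  note chain = Suc.prems(1,2,3) and s = Suc.prems(4) and rel = Suc.prems(5)
  define L where "L n = {l. set l \<subseteq> {..d} \<and> length l = n}" for n
  have finL: "finite (L n)" for n unfolding L_def by (rule finite_lists_length_eq) simp
  define T where "T m = (\<Sum>l\<in>L n. s (m # l) * power_prod (\<lambda>i. a (Suc i)) l)" for m
  have LSuc: "L (Suc n) = (\<lambda>(m, l). m # l) ` ({..d} \<times> L n)"
    by (auto simp: L_def length_Suc_conv image_iff)
  have "(\<Sum>l\<in>L (Suc n). s l * power_prod a l) =
      (\<Sum>(m, l)\<in>{..d} \<times> L n. s (m # l) * power_prod a (m # l))"
    unfolding LSuc by (subst sum.reindex) (auto simp: inj_on_def case_prod_beta intro!: sum.cong)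
  also have "\<dots> = (\<Sum>m\<le>d. a 0 ^ m * T m)"
    by (simp add: T_def sum.cartesian_product[symmetric] sum_distrib_left mult_ac)
  finally have rel': "(\<Sum>m\<le>d. a 0 ^ m * T m) \<in> c 0"
    using rel by (simp add: L_def)
  have all: "\<forall>m\<le>d. \<forall>l\<in>L n. s (m # l) = 0"
  proof (rule ccontr)
    assume "\<not> ?thesis"
    then have ex: "\<exists>m. m \<le> d \<and> (\<exists>l\<in>L n. s (m # l) \<noteq> 0)" by blast
    define m0 where "m0 = (LEAST m. m \<le> d \<and> (\<exists>l\<in>L n. s (m # l) \<noteq> 0))"
    have m0: "m0 \<le> d" "\<exists>l\<in>L n. s (m0 # l) \<noteq> 0"
      using LeastI_ex[OF ex] unfolding m0_def by blast+
    have below: "T m = 0" if "m < m0" for m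
      using not_less_Least[OF that[unfolded m0_def]] that m0(1) by (auto simp: T_def intro!: sum.neutral)
    \<comment> \<open>The terms beyond \<open>m0\<close> add up to \<open>a 0 ^ (m0 + 1)\<close>
      times \<open>U\<close>.\<close>
    define U where "U = (\<Sum>m\<in>{m0<..d}. a 0 ^ (m - Suc m0) * T m)"
    have "(\<Sum>m\<le>d. a 0 ^ m * T m) = (\<Sum>m\<in>{m0..d}. a 0 ^ m * T m)"
      by (rule sum.mono_neutral_right) (auto simp: below)
    also have "{m0..d} = insert m0 {m0<..d}" using m0(1) by auto
    also have "(\<Sum>m\<in>\<dots>. a 0 ^ m * T m) = a 0 ^ m0 * T m0 + (\<Sum>m\<in>{m0<..d}. a 0 ^ m * T m)"
      by simp
    also have "(\<Sum>m\<in>{m0<..d}. a 0 ^ m * T m) = a 0 ^ m0 * (a 0 * U)"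
      unfolding U_def sum_distrib_left
    proof (rule sum.cong)
      fix m assume "m \<in> {m0<..d}"
      then have "m = m0 + Suc (m - Suc m0)" by auto
      then have "a 0 ^ m = a 0 ^ m0 * (a 0 * a 0 ^ (m - Suc m0))"
        by (metis power_Suc power_add)
      then show "a 0 ^ m * T m = a 0 ^ m0 * (a 0 * (a 0 ^ (m - Suc m0) * T m))"
        by (simp add: mult_ac)
    qed simp
    finally have "a 0 ^ m0 * (T m0 + a 0 * U) \<in> c 0"
      using rel' by (simp add: distrib_left)
    \<comment> \<open>\<open>c 0\<close> is prime and does not contain \<open>a 0\<close>, so the
      factor \<open>a 0 ^ m0\<close> cancels. Since \<open>a 0\<close> lies in \<open>c 1\<close>,
      only \<open>T m0\<close> remains modulo \<open>c 1\<close>.\<close>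
    then have "T m0 + a 0 * U \<in> c 0"
      using chain(1)[of 0] chain(3)[of 0] by (auto dest: prime_ideal_multD prime_ideal_powerD)
    moreover have "a 0 * U \<in> c 1"
      using chain(1)[of 1] chain(3)[of 0] by (auto intro: is_ideal_mult_right prime_ideal_is_ideal)
    ultimately have "T m0 \<in> c 1"
      using is_ideal_diff[of "c 1" "T m0 + a 0 * U" "a 0 * U"] chain(1)[of 1] chain(2)[of 0]
      by (auto dest: prime_ideal_is_ideal)
    \<comment> \<open>\<open>T m0 \<in> c 1\<close> is a relation for the shifted chain, which is
      shorter by one.\<close>
    have "s (m0 # l) = 0" if "l \<in> L n" for l
    proof (rule Suc.IH[of "\<lambda>i. c (Suc i)" "\<lambda>i. a (Suc i)" "\<lambda>l. s (m0 # l)"])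
      show "(\<Sum>l | set l \<subseteq> {..d} \<and> length l = n. s (m0 # l) * power_prod (\<lambda>i. a (Suc i)) l) \<in> c (Suc 0)"
        using \<open>T m0 \<in> c 1\<close> by (simp add: T_def L_def)
    qed (use chain s[of "m0 # _"] m0(1) that in \<open>auto simp: L_def\<close>)
    then show False using m0(2) by blast
  qed
  obtain m k where "l = m # k" using Suc.prems(7) by (cases l) auto
  then show ?case using all Suc.prems(6,7) by (auto simp: L_def)
qed

section \<open>Counting polynomials with bounded exponents\<close>

lemma finite_exponent_box: "finite {f :: 'v::finite \<Rightarrow>\<^sub>0 nat. \<forall>v. lookup f v \<le> B v}"
  and card_exponent_box: "card {f :: 'v::finite \<Rightarrow>\<^sub>0 nat. \<forall>v. lookup f v \<le> B v} = (\<Prod>v\<in>UNIV. Suc (B v))"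
proof -
  let ?F = "{f :: 'v \<Rightarrow>\<^sub>0 nat. \<forall>v. lookup f v \<le> B v}"
  have "bij_betw lookup ?F (PiE UNIV (\<lambda>v. {..B v}))"
  proof (rule bij_betw_byWitness[where f' = Abs_poly_mapping])
    show "\<forall>f\<in>?F. Abs_poly_mapping (lookup f) = f" by simp
  qed (auto simp: PiE_def)
  then show "finite ?F" "card ?F = (\<Prod>v\<in>UNIV. Suc (B v))"
    by (auto simp: bij_betw_same_card[of lookup] card_PiE bij_betw_finite finite_PiE)
qed

text \<open>Bounding each exponent separately, rather than the total degree, makes the monomials a
  box, whose size is a power.\<close>

definition exponents_le :: "nat \<Rightarrow> ('v, 'k::comm_ring_1) mpoly set" where
  "exponents_le M = {p. \<forall>m\<in>keys p. \<forall>v. lookup m v \<le> M}"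

lemma exponents_leD: "p \<in> exponents_le M \<Longrightarrow> m \<in> keys p \<Longrightarrow> lookup m v \<le> M"
  by (simp add: exponents_le_def)

lemma exponents_le_mono: "p \<in> exponents_le M \<Longrightarrow> M \<le> N \<Longrightarrow> p \<in> exponents_le N"
  unfolding exponents_le_def by (auto intro: order_trans)

lemma one_in_exponents_le: "1 \<in> exponents_le M"
  by (simp add: exponents_le_def)

lemma mult_in_exponents_le:
  assumes "p \<in> exponents_le M" "q \<in> exponents_le N"
  shows "p * q \<in> exponents_le (M + N)"
  unfolding exponents_le_def
proof (intro CollectI ballI allI)
  fix m v assume "m \<in> keys (p * q)"
  then obtain m1 m2 where "m1 \<in> keys p" "m2 \<in> keys q" "m = m1 + m2" using keys_mult[of p q] by blast
  then show "lookup m v \<le> M + N"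
    using exponents_leD[OF assms(1)] exponents_leD[OF assms(2)] by (simp add: lookup_add add_mono)
qed

lemma power_in_exponents_le: "p \<in> exponents_le M \<Longrightarrow> p ^ k \<in> exponents_le (k * M)"
proof (induction k)
  case (Suc k)
  then show ?case using mult_in_exponents_le[of p M "p ^ k" "k * M"] by simp
qed (simp add: one_in_exponents_le)

lemma power_prod_in_exponents_le:
  "set l \<subseteq> {..d} \<Longrightarrow> (\<And>i. i < length l \<Longrightarrow> a i \<in> exponents_le D) \<Longrightarrow>
    power_prod a l \<in> exponents_le (length l * (d * D))"
proof (induction l arbitrary: a)
  case (Cons m l)
  have "a 0 ^ m \<in> exponents_le (m * D)" using Cons.prems by (intro power_in_exponents_le) auto
  then have "a 0 ^ m \<in> exponents_le (d * D)" by (rule exponents_le_mono) (use Cons.prems in auto)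
  moreover have "power_prod (\<lambda>i. a (Suc i)) l \<in> exponents_le (length l * (d * D))"
    by (rule Cons.IH) (use Cons.prems in auto)
  ultimately have "a 0 ^ m * power_prod (\<lambda>i. a (Suc i)) l \<in> exponents_le (d * D + length l * (d * D))"
    by (rule mult_in_exponents_le)
  then show ?case by simp
qed (simp add: one_in_exponents_le)

lemma exponents_le_subset_span:
  "(exponents_le M :: ('v, 'k::field) mpoly set) \<subseteq>
    mpoly_space.span ((\<lambda>m. single m 1) ` {m. \<forall>v. lookup m v \<le> M})"
proof
  fix p :: "('v, 'k) mpoly" assume p: "p \<in> exponents_le M"
  let ?T = "(\<lambda>m. single m 1 :: ('v, 'k) mpoly) ` {m. \<forall>v. lookup m v \<le> M}"
  have "single m (lookup p m) \<in> mpoly_space.span ?T" if "m \<in> keys p" for m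
  proof -
    have "single m 1 \<in> ?T" using exponents_leD[OF p that] by blast
    from mpoly_space.span_scale[OF mpoly_space.span_base[OF this], of "lookup p m"] show ?thesis
      by (simp add: mult_single)
  qed
  then have "(\<Sum>m\<in>keys p. single m (lookup p m)) \<in> mpoly_space.span ?T"
    by (rule mpoly_space.span_sum)
  then show "p \<in> mpoly_space.span ?T" by (simp add: poly_mapping_sum_monomials)
qed

text \<open>For \<open>a i \<in> c (Suc i) - c i\<close>, the products of powers of the \<open>a i\<close> with monomials in the
  variables outside \<open>C\<close> are linearly independent. If \<open>n > card C\<close>, there are too many of them with
  exponents bounded by a large \<open>d\<close>; \<open>d = E ^ N\<close> suffices.\<close>

lemma prime_chain_length_le:
  fixes c :: "nat \<Rightarrow> ('v::finite, 'k::field) mpoly set"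
  assumes prime: "\<And>i. i \<le> n \<Longrightarrow> prime_ideal (c i)" and strict: "\<And>i. i < n \<Longrightarrow> c i \<subset> c (Suc i)"
    and top: "c n = var_ideal C"
  shows "n \<le> card C"
proof (rule ccontr)
  assume "\<not> n \<le> card C"
  then have n: "card C < n" by simp
  have "\<forall>i. \<exists>x. i < n \<longrightarrow> x \<in> c (Suc i) - c i" using strict by blast
  then obtain a where a: "\<And>i. i < n \<Longrightarrow> a i \<in> c (Suc i) - c i" by metis
  have "finite (\<Union>i<n. \<Union>m\<in>keys (a i). range (lookup m))" by simp
  then obtain D where "\<forall>x\<in>(\<Union>i<n. \<Union>m\<in>keys (a i). range (lookup m)). x \<le> D"
    unfolding finite_nat_set_iff_bounded_le by blast
  then have D: "a i \<in> exponents_le D" if "i < n" for i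
    using that unfolding exponents_le_def by blast
  define N where "N = card (UNIV :: 'v set)"
  \<comment> \<open>\<open>E\<close> is chosen so that \<open>M + 1 \<le> E * (d + 1)\<close>, and
    \<open>d\<close> so that \<open>(E * (d + 1)) ^ N = d * (d + 1) ^ N\<close>, which is less than
    \<open>(d + 1) ^ (N + 1)\<close>.\<close>
  define E where "E = n * D + 1"
  define d where "d = E ^ N"
  define M where "M = n * (d * D) + d"
  define L where "L = {l. set l \<subseteq> {..d} \<and> length l = n}"
  define F where "F = {f :: 'v \<Rightarrow>\<^sub>0 nat. \<forall>v. lookup f v \<le> (if v \<in> C then 0 else d)}"
  let ?T = "(\<lambda>m. single m 1 :: ('v, 'k) mpoly) ` {m. \<forall>v. lookup m v \<le> M}"
  have finL: "finite L" unfolding L_def by (rule finite_lists_length_eq) simp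
  have finF: "finite F" unfolding F_def by (rule finite_exponent_box)
  have "card (L \<times> F) \<le> card ?T"
  proof (rule mpoly_space.card_le_if_indep_family)
    fix i :: "nat list \<times> ('v \<Rightarrow>\<^sub>0 nat)" assume "i \<in> L \<times> F"
    then have l: "set (fst i) \<subseteq> {..d}" "length (fst i) = n" and f: "snd i \<in> F"
      by (auto simp: L_def)
    have "power_prod a (fst i) \<in> exponents_le (n * (d * D))"
      using power_prod_in_exponents_le[OF l(1), of a D] D l(2) by simp
    moreover have "lookup (snd i) v \<le> (if v \<in> C then 0 else d)" for v
      using f unfolding F_def by blast
    then have "lookup (snd i) v \<le> d" for v
      by (rule order_trans) simp
    then have "single (snd i) 1 \<in> exponents_le d" by (simp add: exponents_le_def)
    ultimately have "power_prod a (fst i) * single (snd i) 1 \<in> exponents_le M"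
      unfolding M_def by (rule mult_in_exponents_le)
    then show "power_prod a (fst i) * single (snd i) 1 \<in> mpoly_space.span ?T"
      by (rule subsetD[OF exponents_le_subset_span])
  next
    fix q :: "nat list \<times> ('v \<Rightarrow>\<^sub>0 nat) \<Rightarrow> 'k" and i
    assume rel: "(\<Sum>i\<in>L \<times> F. single 0 (q i) * (power_prod a (fst i) * single (snd i) 1)) = 0"
      and i: "i \<in> L \<times> F"
    \<comment> \<open>Grouping the relation by \<open>l\<close> turns the scalars into polynomials
      \<open>s l\<close> in the variables outside \<open>C\<close>.\<close>
    define s where "s l = (\<Sum>f\<in>F. single f (q (l, f)))" for l
    have lookup_s: "lookup (s l) m = (if m \<in> F then q (l, m) else 0)" for l m
      using finF by (simp add: s_def lookup_sum lookup_single when_def)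
    have "single 0 (q i) * (power_prod a (fst i) * single (snd i) 1) =
        single (snd i) (q i) * power_prod a (fst i)" for i
    proof -
      have "single 0 (q i) * (power_prod a (fst i) * single (snd i) 1) =
          single 0 (q i) * single (snd i) 1 * power_prod a (fst i)" by (simp only: mult_ac)
      then show ?thesis by (simp add: mult_single)
    qed
    then have "(\<Sum>i\<in>L \<times> F. single 0 (q i) * (power_prod a (fst i) * single (snd i) 1)) =
        (\<Sum>l\<in>L. s l * power_prod a l)"
      by (simp add: s_def sum_distrib_right sum.cartesian_product case_prod_beta)
    then have rel': "(\<Sum>l | set l \<subseteq> {..d} \<and> length l = n. s l * power_prod a l) = 0"
      using rel by (simp add: L_def)
    have "s (fst i) = 0"
    proof (rule prime_chain_relation_trivial[where c = c and a = a and n = n and d = d])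
      \<comment> \<open>A nonzero \<open>s l\<close> has only monomials free of \<open>C\<close>, so
        it cannot lie in \<open>c n\<close>, which is \<open>var_ideal C\<close>.\<close>
      fix l assume "s l \<in> c n"
      show "s l = 0"
      proof (rule ccontr)
        assume "s l \<noteq> 0"
        then obtain m where m: "m \<in> keys (s l)" by (metis keys_eq_empty all_not_in_conv)
        then obtain v where "v \<in> C" "lookup m v \<noteq> 0"
          using var_idealD[of "s l" C m] \<open>s l \<in> c n\<close> top by auto
        moreover have "m \<in> F" using m lookup_s[of l m] by (auto simp: in_keys_iff split: if_splits)
        then have "lookup m v \<le> (if v \<in> C then 0 else d)" unfolding F_def by blast
        ultimately show False by simp
      qed
    next
      show "(\<Sum>l | set l \<subseteq> {..d} \<and> length l = n. s l * power_prod a l) \<in> c 0"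
        unfolding rel' using prime[of 0] by (simp add: is_ideal_zero prime_ideal_is_ideal)
    qed (use prime strict a i in \<open>auto simp: L_def\<close>)
    then show "q i = 0" using lookup_s[of "fst i" "snd i"] i by auto
  qed (use finL finF finite_exponent_box[of "\<lambda>_. M"] in auto)
  moreover have "card ?T = (M + 1) ^ N"
  proof -
    have "inj_on (\<lambda>m. single m (1::'k)) A" for A :: "('v \<Rightarrow>\<^sub>0 nat) set"
      by (rule inj_onI) (auto dest: arg_cong[of _ _ keys])
    then show ?thesis by (simp add: card_image card_exponent_box N_def)
  qed
  moreover have "card F = (d + 1) ^ (N - card C)"
  proof -
    have "card F = (\<Prod>v\<in>UNIV. if v \<in> - C then d + 1 else 1)"
      unfolding F_def card_exponent_box by (rule prod.cong) auto
    also have "\<dots> = (d + 1) ^ card (- C)" by (subst prod.If_cases) (simp_all add: Compl_eq)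
    finally show ?thesis by (simp add: Compl_eq_Diff_UNIV card_Diff_subset N_def)
  qed
  moreover have "card L = (d + 1) ^ n" unfolding L_def by (simp add: card_lists_length_eq)
  ultimately have count: "(d + 1) ^ n * (d + 1) ^ (N - card C) \<le> (M + 1) ^ N"
    by (simp add: card_cartesian_product)
  have "card C \<le> N" unfolding N_def by (rule card_mono) auto
  \<comment> \<open>Because \<open>card C < n\<close>, there is at least one factor
    \<open>d + 1\<close> more than the number \<open>N\<close> of variables.\<close>
  then have "(d + 1) ^ (N + 1) \<le> (d + 1) ^ (n + (N - card C))"
    using n by (intro power_increasing) auto
  also have "\<dots> \<le> (M + 1) ^ N" using count by (simp only: power_add)
  also have "\<dots> \<le> (E * (d + 1)) ^ N"
    by (intro power_mono) (auto simp: M_def E_def algebra_simps)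
  also have "\<dots> = d * (d + 1) ^ N" by (simp only: power_mult_distrib d_def)
  finally have "(d + 1) * (d + 1) ^ N \<le> d * (d + 1) ^ N" by simp
  then show False by simp
qed

lemma prime_height_var_ideal_le:
  "prime_height (var_ideal C :: ('v::finite, 'k::field) mpoly set) \<le> enat (card C)"
  unfolding prime_height_def
proof (rule Sup_least, clarify)
  fix n and c :: "nat \<Rightarrow> ('v, 'k) mpoly set"
  assume "\<forall>i\<le>n. prime_ideal (c i)" "\<forall>i<n. c i \<subset> c (Suc i)" "c n = var_ideal C"
  then show "enat n \<le> enat (card C)" using prime_chain_length_le[of n c C] by simp
qed

text \<open>Adding the variables of \<open>C\<close> one at a time gives a strict chain of primes
  below \<open>P\<close>.\<close>

lemma card_le_prime_height:
  fixes P :: "('v::finite, 'k::field) mpoly set"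
  assumes P: "prime_ideal P" and sub: "var_ideal C \<subseteq> P"
  shows "enat (card C) \<le> prime_height P"
proof -
  obtain h where h: "bij_betw h {0..<card C} C" using ex_bij_betw_nat_finite[of C] by auto
  \<comment> \<open>The top member is \<open>P\<close> itself, which may be larger than
    \<open>var_ideal C\<close>, because \<open>prime_height\<close> counts chains ending in
    \<open>P\<close>.\<close>
  define c where "c i = (if i < card C then var_ideal (h ` {..<i}) else P)" for i
  have "c i \<subset> c (Suc i)" if i: "i < card C" for i
  proof -
    let ?x = "single (single (h i) 1) 1 :: ('v, 'k) mpoly"
    have "h i \<notin> h ` {..<i}"
    proof
      assume "h i \<in> h ` {..<i}"
      then obtain j where "j < i" "h i = h j" by auto
      then show False using h i inj_onD[of h "{0..<card C}" i j] by (simp add: bij_betw_def)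
    qed
    moreover have ci: "c i = var_ideal (h ` {..<i})" using i by (simp add: c_def)
    ultimately have 1: "?x \<notin> c i" by (simp only: var_mem_var_ideal_iff not_False_eq_True)
    have "h ` {..<Suc i} \<subseteq> C" using h i by (auto simp: bij_betw_def)
    then have 2: "var_ideal (h ` {..<Suc i}) \<subseteq> c (Suc i)"
      using sub var_ideal_mono[of "h ` {..<Suc i}" C] by (auto simp: c_def)
    have "?x \<in> var_ideal (h ` {..<Suc i})" unfolding var_mem_var_ideal_iff by simp
    moreover have "c i \<subseteq> var_ideal (h ` {..<Suc i})"
      unfolding ci by (intro var_ideal_mono) auto
    ultimately show ?thesis using 1 2 by blast
  qed
  moreover have "prime_ideal (c i)" for i by (simp add: c_def P prime_ideal_var_ideal)
  moreover have "c (card C) = P" by (simp add: c_def)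
  ultimately show ?thesis unfolding prime_height_def by (intro Sup_upper) blast
qed

section \<open>The height of an edge ideal as a vertex cover number\<close>

definition edge_exponent :: "'v set \<Rightarrow> 'v \<Rightarrow>\<^sub>0 nat" where
  "edge_exponent e = (\<Sum>x\<in>e. single x 1)"

lemma lookup_edge_exponent: "lookup (edge_exponent e) v = (if v \<in> e then 1 else 0)"
  for e :: "'v::finite set"
  by (simp add: edge_exponent_def lookup_sum lookup_single when_def)

lemma edge_monomial_eq: "edge_monomial e = single (edge_exponent e) 1"
  by (simp add: edge_monomial_def edge_exponent_def)

text \<open>Covers and primes above the ideal are compared in both directions. If the empty set is
  an edge, there is neither a cover nor such a prime, and both infima are infinite.\<close>

theorem ideal_height_edge_ideal:
  fixes H :: "'v::finite set set"
  shows "ideal_height (edge_ideal H :: ('v, 'k::field) mpoly set) =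
    (INF C\<in>{C. \<forall>e\<in>H. e \<inter> C \<noteq> {}}. enat (card C))"
proof (rule antisym)
  show "ideal_height (edge_ideal H :: ('v, 'k) mpoly set) \<le> (INF C\<in>{C. \<forall>e\<in>H. e \<inter> C \<noteq> {}}. enat (card C))"
  proof (rule INF_greatest)
    fix C assume C: "C \<in> {C. \<forall>e\<in>H. e \<inter> C \<noteq> {}}"
    have "edge_monomial e \<in> (var_ideal C :: ('v, 'k) mpoly set)" if "e \<in> H" for e
    proof -
      have "e \<inter> C \<noteq> {}" using C that by simp
      then obtain v where "v \<in> e" "v \<in> C" by auto
      then have "\<exists>v\<in>C. lookup (edge_exponent e) v \<noteq> 0"
        by (intro bexI[of _ v]) (simp_all add: lookup_edge_exponent)
      then show ?thesis by (simp add: edge_monomial_eq var_ideal_def)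
    qed
    then have "edge_ideal H \<subseteq> (var_ideal C :: ('v, 'k) mpoly set)"
      unfolding edge_ideal_def by (intro gen_ideal_minimal is_ideal_var_ideal) auto
    then have "ideal_height (edge_ideal H :: ('v, 'k) mpoly set) \<le> prime_height (var_ideal C :: ('v, 'k) mpoly set)"
      unfolding ideal_height_def
      using prime_ideal_var_ideal by (intro Inf_lower) blast
    also have "\<dots> \<le> enat (card C)" by (rule prime_height_var_ideal_le)
    finally show "ideal_height (edge_ideal H :: ('v, 'k) mpoly set) \<le> enat (card C)" .
  qed
next
  show "(INF C\<in>{C. \<forall>e\<in>H. e \<inter> C \<noteq> {}}. enat (card C)) \<le> ideal_height (edge_ideal H :: ('v, 'k) mpoly set)"
    unfolding ideal_height_def
  proof (rule Inf_greatest, clarify)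
    fix P :: "('v, 'k) mpoly set" assume P: "prime_ideal P" and sub: "edge_ideal H \<subseteq> P"
    define C where "C = {v. single (single v 1) 1 \<in> P}"
    have "e \<inter> C \<noteq> {}" if "e \<in> H" for e
    proof -
      have "edge_monomial e \<in> P"
        using sub gen_ideal_superset[of "edge_monomial ` H"] that unfolding edge_ideal_def by blast
      \<comment> \<open>A prime containing a product of variables contains one of them, so
        \<open>C\<close> meets \<open>e\<close>.\<close>
      then have "(\<Prod>x\<in>e. single (single x 1) 1) \<in> P"
        by (simp add: edge_monomial_def single_sum_exponents)
      then have "\<exists>x\<in>e. single (single x 1) 1 \<in> P" by (rule prime_ideal_prodD[OF P finite])
      then show ?thesis unfolding C_def by blast
    qed
    then have le: "(INF C\<in>{C. \<forall>e\<in>H. e \<inter> C \<noteq> {}}. enat (card C)) \<le> enat (card C)"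
      by (intro INF_lower) simp
    have "var_ideal C \<subseteq> P"
      using prime_ideal_is_ideal[OF P] by (rule var_ideal_subset) (simp add: C_def)
    then have "enat (card C) \<le> prime_height P" by (rule card_le_prime_height[OF P])
    with le show "(INF C\<in>{C. \<forall>e\<in>H. e \<inter> C \<noteq> {}}. enat (card C)) \<le> prime_height P"
      by (rule order_trans)
  qed
qed

subsection \<open>The number of generators of an edge ideal\<close>

lemma edge_exponent_eq_iff: "edge_exponent e = edge_exponent f \<longleftrightarrow> e = f"
  for e :: "'v::finite set"
proof
  assume eq: "edge_exponent e = edge_exponent f"
  show "e = f"
  proof (rule set_eqI)
    fix v
    show "v \<in> e \<longleftrightarrow> v \<in> f"
      using arg_cong[OF eq, of "\<lambda>m. lookup m v"] by (simp add: lookup_edge_exponent split: if_splits)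
  qed
qed simp

lemma lookup_edge_monomial:
  "lookup (edge_monomial f) (edge_exponent e) = (if e = f then 1 else 0)"
  for e :: "'v::finite set"
  using edge_exponent_eq_iff[of f e] by (auto simp: edge_monomial_eq lookup_single when_def)

text \<open>Every monomial of \<open>f\<close> is divisible by the monomial of some edge
  \<open>d\<close>. If it also divides the monomial of \<open>e\<close>, the antichain condition
  forces \<open>d = e\<close>, so the cofactor is 1.\<close>

lemma lookup_mult_edge_ideal:
  fixes f :: "('v::finite, 'k::comm_ring_1) mpoly"
  assumes anti: "\<And>e e'. e \<in> H \<Longrightarrow> e' \<in> H \<Longrightarrow> e' \<subseteq> e \<Longrightarrow> e' = e"
    and f: "f \<in> edge_ideal H" and e: "e \<in> H"
  shows "lookup (r * f) (edge_exponent e) = lookup r 0 * lookup f (edge_exponent e)"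
proof -
  let ?S = "{m :: 'v \<Rightarrow>\<^sub>0 nat. \<exists>e\<in>H. \<forall>v\<in>e. lookup m v \<noteq> 0}"
  have "edge_ideal H \<subseteq> {p :: ('v, 'k) mpoly. keys p \<subseteq> ?S}"
    unfolding edge_ideal_def
  proof (rule gen_ideal_minimal)
    show "is_ideal {p :: ('v, 'k) mpoly. keys p \<subseteq> ?S}"
      by (rule is_ideal_monomial_ideal) (fastforce simp: lookup_add)
    have "edge_exponent d \<in> ?S" if "d \<in> H" for d
      using that by (auto simp: lookup_edge_exponent intro!: bexI[of _ d])
    then show "edge_monomial ` H \<subseteq> {p :: ('v, 'k) mpoly. keys p \<subseteq> ?S}"
      by (auto simp: edge_monomial_eq)
  qed
  then have keys_f: "keys f \<subseteq> ?S" using f by blast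
  have "lookup (r * f) (0 + edge_exponent e) = lookup r 0 * lookup f (edge_exponent e)"
  proof (rule lookup_mult_unique_pair)
    fix k m assume m: "m \<in> keys f" and eq: "k + m = 0 + edge_exponent e"
    have sum: "lookup k v + lookup m v = (if v \<in> e then 1 else 0)" for v
      using arg_cong[OF eq, of "\<lambda>p. lookup p v"] by (simp add: lookup_add lookup_edge_exponent)
    obtain d where d: "d \<in> H" "\<forall>v\<in>d. lookup m v \<noteq> 0" using m keys_f by blast
    have "d \<subseteq> e"
    proof
      fix v assume "v \<in> d"
      then show "v \<in> e" using sum[of v] d(2) by (auto split: if_splits)
    qed
    then have "d = e" using anti[OF e d(1)] by simp
    have "lookup k v = 0" for v
    proof (cases "v \<in> e")
      case True
      then have "lookup m v \<noteq> 0" using d(2) \<open>d = e\<close> by blast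
      then show ?thesis using sum[of v] True by simp
    next
      case False
      then show ?thesis using sum[of v] by simp
    qed
    then have "k = 0" by (intro poly_mapping_eqI) simp
    then show "k = 0 \<and> m = edge_exponent e" using eq by simp
  qed
  then show ?thesis by simp
qed

text \<open>Lower bound: on the ideal, the coefficients at the edge monomials depend \<open>K\<close>-linearly on
  the coefficients of the generators, because only the constant term of a multiplier contributes.\<close>

theorem num_gens_edge_ideal:
  fixes H :: "'v::finite set set"
  assumes anti: "\<And>e e'. e \<in> H \<Longrightarrow> e' \<in> H \<Longrightarrow> e' \<subseteq> e \<Longrightarrow> e' = e"
  shows "num_gens (edge_ideal H :: ('v, 'k::field) mpoly set) = enat (card H)"
proof (rule antisym)
  let ?I = "edge_ideal H :: ('v, 'k) mpoly set"
  have "inj_on (edge_monomial :: 'v set \<Rightarrow> ('v, 'k) mpoly) H"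
  proof (rule inj_onI)
    fix d e :: "'v set" assume eq: "edge_monomial d = (edge_monomial e :: ('v, 'k) mpoly)"
    show "d = e"
      using arg_cong[OF eq, of keys] by (simp add: edge_monomial_eq edge_exponent_eq_iff)
  qed
  then have "card (edge_monomial ` H :: ('v, 'k) mpoly set) = card H" by (rule card_image)
  then show "num_gens ?I \<le> enat (card H)"
    unfolding num_gens_def
    by (intro Inf_lower CollectI exI[of _ "edge_monomial ` H :: ('v, 'k) mpoly set"])
       (simp add: edge_ideal_def)
  show "enat (card H) \<le> num_gens ?I"
    unfolding num_gens_def
  proof (rule Inf_greatest, clarify)
    fix G :: "('v, 'k) mpoly set" assume G: "finite G" "gen_ideal G = ?I"
    \<comment> \<open>The projection onto the span of the edge monomials. On the ideal it turns
      multiplication by \<open>r\<close> into scaling by the constant term of \<open>r\<close>,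
      which makes \<open>W\<close> an ideal.\<close>
    define \<pi> where "\<pi> f = (\<Sum>e\<in>H. single (edge_exponent e) (lookup f (edge_exponent e)))" for f :: "('v, 'k) mpoly"
    define W where "W = {f \<in> ?I. \<pi> f \<in> mpoly_space.span (\<pi> ` G)}"
    have I: "is_ideal ?I" unfolding edge_ideal_def by (rule is_ideal_gen_ideal)
    have \<pi>_add: "\<pi> (f + g) = \<pi> f + \<pi> g" for f g
      by (simp add: \<pi>_def lookup_add single_add sum.distrib)
    have \<pi>_zero: "\<pi> 0 = 0" by (simp add: \<pi>_def)
    have \<pi>_mult: "\<pi> (r * f) = single 0 (lookup r 0) * \<pi> f" if "f \<in> ?I" for r f
      using lookup_mult_edge_ideal[OF anti that, of _ r]
      by (simp add: \<pi>_def sum_distrib_left mult_single)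
    have "is_ideal W"
      using is_ideal_zero[OF I] is_ideal_add[OF I] is_ideal_mult[OF I]
      by (simp add: is_ideal_def W_def \<pi>_add \<pi>_mult \<pi>_zero mpoly_space.span_zero
        mpoly_space.span_add mpoly_space.span_scale)
    moreover have "G \<subseteq> W"
      using gen_ideal_superset[of G] G(2) by (auto simp: W_def intro: mpoly_space.span_base)
    ultimately have "?I \<subseteq> W" using gen_ideal_minimal G(2) by blast
    \<comment> \<open>The edge monomials are fixed by \<open>\<pi>\<close>, so they are independent
      vectors in the span of the projected generators.\<close>
    have "card H \<le> card (\<pi> ` G)"
    proof (rule mpoly_space.card_le_if_indep_family)
      fix e assume e: "e \<in> H"
      have "edge_monomial e \<in> ?I"
        using gen_ideal_superset[of "edge_monomial ` H"] e unfolding edge_ideal_def by blast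
      moreover have "\<pi> (edge_monomial e) = edge_monomial e"
      proof -
        have "\<pi> (edge_monomial e) = (\<Sum>d\<in>H. if d = e then edge_monomial e else 0)"
          unfolding \<pi>_def lookup_edge_monomial by (rule sum.cong) (auto simp: edge_monomial_eq)
        then show ?thesis using e by simp
      qed
      ultimately show "edge_monomial e \<in> mpoly_space.span (\<pi> ` G)"
        using \<open>?I \<subseteq> W\<close> by (auto simp: W_def)
    next
      fix q e assume rel: "(\<Sum>e\<in>H. single 0 (q e) * edge_monomial e) = (0 :: ('v, 'k) mpoly)" and e: "e \<in> H"
      have "single 0 (q d) * edge_monomial d = (single (edge_exponent d) (q d) :: ('v, 'k) mpoly)" for d
        by (simp add: edge_monomial_eq mult_single)
      then have "lookup (\<Sum>e\<in>H. single (edge_exponent e) (q e)) (edge_exponent e) = 0" using rel by simp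
      moreover have "lookup (\<Sum>e\<in>H. single (edge_exponent e) (q e)) (edge_exponent e) = (\<Sum>d\<in>H. if d = e then q e else 0)"
        unfolding lookup_sum lookup_single edge_exponent_eq_iff
        by (rule sum.cong) (auto simp: when_def)
      ultimately show "q e = 0" using e by simp
    qed (use G in auto)
    also have "\<dots> \<le> card G" using G(1) by (rule card_image_le)
    finally show "enat (card H) \<le> enat (card G)" by simp
  qed
qed

text \<open>Cardinalities are well-ordered, so an infimum over a nonempty set of covers is attained;
  this replaces the \<open>enat\<close> equation by a statement about one minimum cover.\<close>

lemma almost_complete_intersection_edge_ideal_iff:
  fixes H :: "'v::finite set set"
  assumes anti: "\<And>e e'. e \<in> H \<Longrightarrow> e' \<in> H \<Longrightarrow> e' \<subseteq> e \<Longrightarrow> e' = e"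
  shows "almost_complete_intersection (edge_ideal H :: ('v, 'k::field) mpoly set) \<longleftrightarrow>
    (\<exists>C. (\<forall>e\<in>H. e \<inter> C \<noteq> {}) \<and> card H = card C + 1 \<and>
      (\<forall>C'. (\<forall>e\<in>H. e \<inter> C' \<noteq> {}) \<longrightarrow> card C \<le> card C'))"
proof -
  have num_gens: "num_gens (edge_ideal H :: ('v, 'k) mpoly set) = enat (card H)"
    by (rule num_gens_edge_ideal) (rule anti)
  define \<C> where "\<C> = {C. \<forall>e\<in>H. e \<inter> C \<noteq> {}}"
  have "almost_complete_intersection (edge_ideal H :: ('v, 'k) mpoly set) \<longleftrightarrow>
      enat (card H) = (INF C\<in>\<C>. enat (card C)) + 1"
    unfolding almost_complete_intersection_def ideal_height_edge_ideal \<C>_def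
    by (simp only: num_gens)
  also have "\<dots> \<longleftrightarrow> (\<exists>C\<in>\<C>. card H = card C + 1 \<and> (\<forall>C'\<in>\<C>. card C \<le> card C'))"
  \<comment> \<open>Without covers the infimum is infinite and cannot satisfy the equation with the
    finite \<open>card H\<close>.\<close>
  proof (cases "\<C> = {}")
    case False
    obtain C where C: "C \<in> \<C>" "\<And>C'. C' \<in> \<C> \<Longrightarrow> card C \<le> card C'"
      using False ex_has_least_nat[of "\<lambda>C. C \<in> \<C>" _ card] by blast
    have "(INF C\<in>\<C>. enat (card C)) = enat (card C)"
      using C by (intro antisym INF_lower INF_greatest) auto
    then have "enat (card H) = (INF C\<in>\<C>. enat (card C)) + 1 \<longleftrightarrow> card H = card C + 1"
      by (simp add: one_enat_def)
    also have "\<dots> \<longleftrightarrow> (\<exists>D\<in>\<C>. card H = card D + 1 \<and> (\<forall>C'\<in>\<C>. card D \<le> card C'))"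
    proof
      assume "\<exists>D\<in>\<C>. card H = card D + 1 \<and> (\<forall>C'\<in>\<C>. card D \<le> card C')"
      then obtain D where "D \<in> \<C>" "card H = card D + 1" "card D \<le> card C" using C(1) by blast
      then show "card H = card C + 1" using C(2)[of D] by simp
    qed (use C in blast)
    finally show ?thesis .
  qed (simp add: top_enat_def)
  finally show ?thesis by (simp add: \<C>_def)
qed

subsection \<open>Vertex covers of complete multipartite hypergraphs\<close>

text \<open>A set \<open>D\<close> meeting all of \<open>A \<subseteq> H\<close> extends to a vertex cover by one vertex from each other
  edge.\<close>

lemma card_le_if_meets:
  fixes H :: "'v::finite set set"
  assumes large: "\<And>C. (\<forall>e\<in>H. e \<inter> C \<noteq> {}) \<Longrightarrow> card H \<le> card C + 1"
    and ne: "{} \<notin> H" and A: "A \<subseteq> H" and D: "\<And>e. e \<in> A \<Longrightarrow> e \<inter> D \<noteq> {}"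
  shows "card A \<le> card D + 1"
proof -
  define C where "C = D \<union> (\<lambda>e. SOME v. v \<in> e) ` (H - A)"
  have "e \<inter> C \<noteq> {}" if "e \<in> H" for e
  proof (cases "e \<in> A")
    case False
    have "(SOME v. v \<in> e) \<in> e" using ne that by (metis all_not_in_conv someI_ex)
    then show ?thesis using that False by (auto simp: C_def)
  qed (use D in \<open>auto simp: C_def\<close>)
  then have "card H \<le> card C + 1" using large by blast
  also have "card C \<le> card D + card ((\<lambda>e. SOME v. v \<in> e) ` (H - A))"
    unfolding C_def by (rule card_Un_le)
  also have "card ((\<lambda>e. SOME v. v \<in> e) ` (H - A)) \<le> card (H - A)" by (rule card_image_le) simp
  also have "card (H - A) = card H - card A" using A by (intro card_Diff_subset) auto
  finally show ?thesis using card_mono[OF _ A] by simp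
qed

text \<open>Representatives of the sides that \<open>X\<close> misses complete it. All subsets of
  size \<open>s\<close> of the result are edges, which supplies edges through prescribed
  vertices.\<close>

lemma ex_transversal:
  fixes side :: "'v::finite \<Rightarrow> nat"
  assumes onto: "side ` UNIV = {..<t}" and inj: "inj_on side X"
  shows "\<exists>T. X \<subseteq> T \<and> inj_on side T \<and> side ` T = {..<t} \<and> card T = t"
proof -
  have "\<forall>i. \<exists>x. i < t \<longrightarrow> side x = i" using onto by (metis imageE lessThan_iff)
  then obtain r where r: "\<And>i. i < t \<Longrightarrow> side (r i) = i" by metis
  define T where "T = X \<union> r ` ({..<t} - side ` X)"
  have "inj_on side T"
  proof (rule inj_onI)
    have T: "x \<in> X \<or> side x \<notin> side ` X \<and> r (side x) = x" if "x \<in> T" for x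
      using that r by (auto simp: T_def)
    fix x y assume "x \<in> T" "y \<in> T" and eq: "side x = side y"
    then show "x = y" using T[of x] T[of y] inj_onD[OF inj eq] by (metis imageI)
  qed
  moreover have img: "side ` T = {..<t}"
  proof
    show "side ` T \<subseteq> {..<t}" using onto by auto
    show "{..<t} \<subseteq> side ` T"
    proof
      fix i assume i: "i \<in> {..<t}"
      then show "i \<in> side ` T"
        using r[of i] unfolding T_def by (cases "i \<in> side ` X") (auto intro: rev_image_eqI[of "r i"])
    qed
  qed
  ultimately have "card T = t" using card_image[of side T] by simp
  then show ?thesis using \<open>inj_on side T\<close> img by (intro exI[of _ T]) (auto simp: T_def)
qed

text \<open>By Pascal's rule the coefficient grows by at least one with \<open>n\<close>; in the new
  case \<open>k = n\<close> it equals \<open>Suc n\<close>.\<close>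

lemma le_binomial: "0 < k \<Longrightarrow> k < n \<Longrightarrow> n \<le> n choose k"
proof (induction n arbitrary: k)
  case (Suc n)
  then obtain j where k: "k = Suc j" by (cases k) auto
  show ?case
  proof (cases "k = n")
    case False
    then have "n \<le> n choose k" using Suc by simp
    moreover have "0 < n choose j" using Suc.prems k by (intro zero_less_binomial) simp
    ultimately show ?thesis unfolding k binomial_Suc_Suc by linarith
  qed simp
qed simp

text \<open>For \<open>t \<ge> 4\<close>, the edges inside a transversal through one of its vertices
  already number at least three, against \<open>few\<close>. For \<open>t = 3\<close> and
  \<open>s = 2\<close>, a side with two vertices gives three edges at a vertex of another
  side.\<close>

lemma few_edges_nonfull:
  fixes side :: "'v::finite \<Rightarrow> nat"
  assumes s: "2 \<le> s" "s < t" and onto: "side ` UNIV = {..<t}"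
    and H: "H = {e. card e = s \<and> inj_on side e}"
    and few: "\<And>A D. A \<subseteq> H \<Longrightarrow> (\<And>e. e \<in> A \<Longrightarrow> e \<inter> D \<noteq> {}) \<Longrightarrow> card A \<le> card D + 1"
  shows "card (UNIV :: 'v set) = 3 \<and> H = {e. card e = 2}"
proof -
  have "t < 4"
  proof (rule ccontr)
    assume "\<not> t < 4"
    obtain x :: 'v where True by simp
    obtain T where T: "x \<in> T" "inj_on side T" "card T = t"
      using ex_transversal[OF onto, of "{x}"] by auto
    define B where "B = {b. b \<subseteq> T - {x} \<and> card b = s - 1}"
    have "insert x b \<in> H" if "b \<in> B" for b
    proof -
      have "card (insert x b) = s" using that s by (subst card_insert_disjoint) (auto simp: B_def)
      moreover have "inj_on side (insert x b)"
        using that T by (intro inj_on_subset[OF T(2)]) (auto simp: B_def)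
      ultimately show ?thesis by (simp add: H)
    qed
    then have "card (insert x ` B) \<le> card {x} + 1" by (intro few) auto
    moreover have "inj_on (insert x) B"
      by (rule inj_onI) (auto simp: B_def dest: insert_ident[THEN iffD1, rotated 2])
    then have "card (insert x ` B) = card B" by (rule card_image)
    moreover have "card B = (t - 1) choose (s - 1)"
      unfolding B_def using T by (subst n_subsets) auto
    moreover have "t - 1 \<le> (t - 1) choose (s - 1)" using s by (intro le_binomial) auto
    ultimately show False using \<open>\<not> t < 4\<close> by simp
  qed
  then have t: "t = 3" "s = 2" using s by auto
  have inj: "inj side"
  proof (rule injI, rule ccontr)
    fix x y assume xy: "side x = side y" "x \<noteq> y"
    obtain T where T: "x \<in> T" "inj_on side T" "card T = 3"
      using ex_transversal[OF onto, of "{x}"] t by auto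
    then have "card (T - {x}) = 2" by simp
    then obtain z w where zw: "T - {x} = {z, w}" "z \<noteq> w" by (auto simp: card_2_iff)
    then have in_T: "z \<in> T" "w \<in> T" "z \<noteq> x" "w \<noteq> x" by auto
    then have sides: "side z \<noteq> side x" "side w \<noteq> side x" "side z \<noteq> side w"
      using inj_onD[OF T(2)] T(1) zw(2) by metis+
    then have "{z, x} \<in> H" "{z, y} \<in> H" "{z, w} \<in> H"
      using xy zw(2) in_T by (auto simp: H t card_2_iff)
    then have "card {{z, x}, {z, y}, {z, w}} \<le> card {z} + 1" by (intro few) auto
    moreover have "card {{z, x}, {z, y}, {z, w}} = 3"
    proof -
      have "z \<noteq> y" "w \<noteq> y" using xy(1) sides by auto
      then show ?thesis using xy(2) in_T(3,4) zw(2) by (simp add: doubleton_eq_iff)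
    qed
    ultimately show False by simp
  qed
  then have "card (UNIV :: 'v set) = 3" using card_image[OF inj] onto t by simp
  moreover have "H = {e. card e = 2}" using inj_on_subset[OF inj] by (auto simp: H t)
  ultimately show ?thesis by blast
qed

lemma card_4_distinct:
  "a \<noteq> b \<Longrightarrow> a \<noteq> d \<Longrightarrow> b \<noteq> c \<Longrightarrow> c \<noteq> d \<Longrightarrow> a \<noteq> c \<Longrightarrow> b \<noteq> d \<Longrightarrow> card {a, b, c, d} = 4"
  by simp

text \<open>If all sides were singletons there would be only one edge. Once a side has two vertices
  \<open>x\<close> and \<open>y\<close>, any vertex beyond \<open>y\<close> and a transversal
  through \<open>x\<close> gives three edges with a common vertex or four edges met by two
  vertices.\<close>

lemma few_edges_full:
  fixes side :: "'v::finite \<Rightarrow> nat"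
  assumes t: "2 \<le> t" and onto: "side ` UNIV = {..<t}"
    and H: "H = {e. card e = t \<and> inj_on side e}" and not1: "card H \<noteq> 1"
    and few: "\<And>A D. A \<subseteq> H \<Longrightarrow> (\<And>e. e \<in> A \<Longrightarrow> e \<inter> D \<noteq> {}) \<Longrightarrow> card A \<le> card D + 1"
  shows "\<exists>x y. x \<noteq> y \<and> card (UNIV :: 'v set) = t + 1 \<and> H = {UNIV - {y}, UNIV - {x}}"
proof -
  have "\<not> inj side"
  proof
    assume inj: "inj side"
    then have card: "card (UNIV :: 'v set) = t" using card_image[OF inj] onto by simp
    have "e = UNIV" if "card e = t" for e :: "'v set"
      using card_subset_eq[of UNIV e] that card by simp
    then have "H = {UNIV}" using inj card by (auto simp: H)
    then show False using not1 by simp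
  qed
  then obtain x y where xy: "side x = side y" "x \<noteq> y" by (auto simp: inj_def)
  obtain T where T: "x \<in> T" "inj_on side T" "side ` T = {..<t}" "card T = t"
    using ex_transversal[OF onto, of "{x}"] by auto
  have TH: "T \<in> H" using T by (simp add: H)
  have swap: "insert b (e - {a}) \<in> H" if e: "e \<in> H" and a: "a \<in> e" and ab: "side b = side a" for a b e
  proof -
    have inj: "inj_on side e" and card: "card e = t" using e by (auto simp: H)
    have *: "side b \<notin> side ` (e - {a})"
    proof
      assume "side b \<in> side ` (e - {a})"
      then obtain c where "c \<in> e" "c \<noteq> a" "side b = side c" by auto
      moreover have "side c = side a" using \<open>side b = side c\<close> ab by (rule trans[OF sym])
      ultimately show False using inj_onD[OF inj _ _ a, of c] by simp
    qed
    then have "b \<notin> e - {a}" by blast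
    then have "card (insert b (e - {a})) = Suc (card (e - {a}))" by simp
    then have "card (insert b (e - {a})) = t" using card a t by simp
    moreover have "inj_on side (insert b (e - {a}))"
      using * inj_on_subset[OF inj, of "e - {a}"] by (auto simp: inj_on_insert)
    ultimately show ?thesis by (simp add: H)
  qed
  have y: "y \<notin> T" using inj_onD[OF T(2) xy(1) T(1)] xy(2) by blast
  have all: "w \<in> T \<or> w = y" for w
  proof (rule ccontr)
    assume "\<not> ?thesis"
    then have w: "w \<notin> T" "w \<noteq> y" by auto
    have "side w \<in> side ` T" using onto T(3) by blast
    then obtain u where u: "u \<in> T" "side w = side u" by blast
    show False
    proof (cases "u = x")
      case True
      \<comment> \<open>A third vertex on the side of \<open>x\<close>: changing the vertex of
        \<open>T\<close> on this side gives three edges that share \<open>z\<close>, which exists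
        because \<open>t \<ge> 2\<close>.\<close>
      have "T \<noteq> {x}" using T(4) t by auto
      then obtain z where z: "z \<in> T" "z \<noteq> x" using T(1) by blast
      let ?A = "{T, insert y (T - {x}), insert w (T - {x})}"
      have "?A \<subseteq> H" using TH swap[OF TH T(1)] xy u True by auto
      then have "card ?A \<le> card {z} + 1" using z by (intro few) auto
      moreover have "T \<noteq> insert y (T - {x})" "T \<noteq> insert w (T - {x})"
          "insert y (T - {x}) \<noteq> insert w (T - {x})"
        using y w by blast+
      then have "card ?A = 3" by simp
      ultimately show False by simp
    next
      case False
      \<comment> \<open>Two sides with two vertices each: independent exchanges give four edges, of
        which \<open>T\<close> and \<open>?e1\<close> contain \<open>x\<close> and the other two
        contain \<open>y\<close>.\<close>
      let ?e1 = "insert w (T - {u})" and ?e2 = "insert y (T - {x})"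
      let ?e3 = "insert w (?e2 - {u})"
      let ?A = "{T, ?e1, ?e2, ?e3}"
      have "?e1 \<in> H" "?e2 \<in> H" using swap[OF TH u(1)] swap[OF TH T(1)] u xy by auto
      moreover from this(2) have "?e3 \<in> H" by (rule swap) (use u False in auto)
      ultimately have le: "card ?A \<le> card {x, y} + 1"
        using TH T(1) False y u by (intro few) auto
      have "T \<noteq> ?e1" "T \<noteq> ?e3" "?e1 \<noteq> ?e2" "?e2 \<noteq> ?e3" using w by blast+
      moreover have "T \<noteq> ?e2" using y by blast
      moreover have "?e1 \<noteq> ?e3"
      proof -
        have "x \<in> ?e1" "x \<notin> ?e3" using T(1) w(1) xy(2) False by auto
        then show ?thesis by blast
      qed
      ultimately have "card ?A = 4" by (intro card_4_distinct)
      then show False using le xy(2) by simp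
    qed
  qed
  then have UNIV: "UNIV = insert y T" by blast
  have card: "card (UNIV :: 'v set) = t + 1" unfolding UNIV using T(4) y by simp
  have "H = {UNIV - {y}, UNIV - {x}}"
  proof
    have "UNIV - {y} = T" "UNIV - {x} = insert y (T - {x})" using UNIV y xy(2) by auto
    then show "{UNIV - {y}, UNIV - {x}} \<subseteq> H" using TH swap[OF TH T(1)] xy by simp
    show "H \<subseteq> {UNIV - {y}, UNIV - {x}}"
    proof
      fix e assume e: "e \<in> H"
      \<comment> \<open>An edge omits a single vertex, and this must be \<open>x\<close> or
        \<open>y\<close> because they share a side.\<close>
      then have "card (UNIV - e) = 1" using card by (simp add: H card_Diff_subset)
      then obtain p where p: "UNIV - e = {p}" by (auto simp: card_1_singleton_iff)
      have "\<not> (x \<in> e \<and> y \<in> e)" using e inj_onD[of side e x y] xy by (auto simp: H)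
      then have "x \<in> UNIV - e \<or> y \<in> UNIV - e" by simp
      then have "p = x \<or> p = y" unfolding p by auto
      moreover have "e = UNIV - {p}" unfolding p[symmetric] by auto
      ultimately show "e \<in> {UNIV - {y}, UNIV - {x}}" by blast
    qed
  qed
  then show ?thesis using card xy(2) by blast
qed

text \<open>The two exchangeable vertices are numbered last, \<open>x\<close> as \<open>t\<close>
  and \<open>y\<close> as \<open>t + 1\<close>, to match the form of the second hypergraph.\<close>

lemma ex_enumeration:
  fixes x y :: "'v::finite"
  assumes "x \<noteq> y" and card: "card (UNIV :: 'v set) = t + 1"
  shows "\<exists>v. bij_betw v {1..t+1} UNIV \<and> UNIV - {y} = v ` {1..t} \<and> UNIV - {x} = v ` ({1..t-1} \<union> {t+1})"
proof -
  have t: "1 \<le> t" using card card_mono[of UNIV "{x, y}"] assms(1) by simp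
  have "card {1..t-1} = card (UNIV - {x, y})" using assms by (simp add: card_Diff_subset)
  then obtain g where g: "bij_betw g {1..t-1} (UNIV - {x, y})"
    using finite_same_card_bij[of "{1..t-1}" "UNIV - {x, y}"] by auto
  define v where "v = g(t := x, t + 1 := y)"
  have v: "v t = x" "v (t + 1) = y" by (auto simp: v_def)
  have img: "v ` {1..t-1} = UNIV - {x, y}"
  proof -
    have "v ` {1..t-1} = g ` {1..t-1}" by (rule image_cong) (auto simp: v_def)
    then show ?thesis using g by (simp add: bij_betw_def)
  qed
  have split: "{1..t} = insert t {1..t-1}" "{1..t+1} = insert (t + 1) (insert t {1..t-1})"
    using t by auto
  have "v ` {1..t+1} = UNIV" unfolding split image_insert img v by auto
  moreover have "inj_on v {1..t+1}" by (rule eq_card_imp_inj_on) (use calculation card in auto)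
  moreover have "UNIV - {y} = v ` {1..t}" unfolding split image_insert img v using assms(1) by auto
  moreover have "UNIV - {x} = v ` ({1..t-1} \<union> {t+1})"
    unfolding image_Un image_insert image_empty img v using assms(1) by auto
  ultimately show ?thesis by (intro exI[of _ v]) (simp add: bij_betw_def)
qed

theorem theorem3p10:
  fixes H :: "('v::finite) set set" and s t :: nat
  assumes "2 \<le> s" and "s \<le> t"
    and "complete_uniform_multipartite s t H"
  shows "almost_complete_intersection (edge_ideal H :: ('v, 'k::field) mpoly set) \<longleftrightarrow>
     ((card (UNIV :: 'v set) = 3 \<and> H = {e. card e = 2}) \<or>
      (\<exists>v :: nat \<Rightarrow> 'v. bij_betw v {1..t+1} UNIV \<and>
          H = {v ` {1..t}, v ` ({1..t-1} \<union> {t+1})}))"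
    (is "_ \<longleftrightarrow> ?a \<or> ?b")
proof -
  obtain side :: "'v \<Rightarrow> nat" where onto: "side ` UNIV = {..<t}" and H: "H = {e. card e = s \<and> inj_on side e}"
    using assms(3) by (auto simp: complete_uniform_multipartite_def)
  have anti: "e' = e" if "e \<in> H" "e' \<in> H" "e' \<subseteq> e" for e e'
    using that card_subset_eq[of e e'] by (simp add: H)
  have ne: "{} \<notin> H" using assms(1) by (auto simp: H)
  let ?aci = "\<exists>C. (\<forall>e\<in>H. e \<inter> C \<noteq> {}) \<and> card H = card C + 1 \<and>
      (\<forall>C'. (\<forall>e\<in>H. e \<inter> C' \<noteq> {}) \<longrightarrow> card C \<le> card C')"
  have "almost_complete_intersection (edge_ideal H :: ('v, 'k) mpoly set) \<longleftrightarrow> ?aci"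
    by (rule almost_complete_intersection_edge_ideal_iff) (rule anti)
  also have "?aci \<longleftrightarrow> ?a \<or> ?b"
  proof
    assume ?aci
    then obtain C where C: "\<forall>e\<in>H. e \<inter> C \<noteq> {}" "card H = card C + 1"
      "\<And>C'. \<forall>e\<in>H. e \<inter> C' \<noteq> {} \<Longrightarrow> card C \<le> card C'" by blast
    \<comment> \<open>\<open>C\<close> is a minimum cover with \<open>card H - 1\<close> elements,
      so no cover is smaller than that, as \<open>card_le_if_meets\<close> requires.\<close>
    have few: "card A \<le> card D + 1" if "A \<subseteq> H" "\<And>e. e \<in> A \<Longrightarrow> e \<inter> D \<noteq> {}" for A D
    proof (rule card_le_if_meets[OF _ ne that])
      show "card H \<le> card C' + 1" if "\<forall>e\<in>H. e \<inter> C' \<noteq> {}" for C' using C(2) C(3)[OF that] by simp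
    qed
    show "?a \<or> ?b"
    proof (cases "s < t")
      case True
      then show ?thesis using few_edges_nonfull[OF assms(1) True onto H few] by blast
    next
      case False
      then have st: "s = t" using assms(2) by simp
      \<comment> \<open>A single edge would force \<open>C\<close> to be empty, but the empty set
        meets no edge.\<close>
      have "card H \<noteq> 1"
      proof
        assume "card H = 1"
        then have "C = {}" "H \<noteq> {}" using C(2) by auto
        then show False using C(1) by blast
      qed
      from few_edges_full[OF _ onto _ this few] H st assms(1) obtain x y
        where "x \<noteq> y" "card (UNIV :: 'v set) = t + 1" "H = {UNIV - {y}, UNIV - {x}}" by auto
      then show ?thesis using ex_enumeration[of x y t] by metis
    qed
  next
    assume "?a \<or> ?b"
    then show ?aci
    proof
      assume a: ?a
      \<comment> \<open>In a triangle any two vertices form a minimum cover of the three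
        edges.\<close>
      obtain C :: "'v set" where C: "card C = 2"
        using a obtain_subset_with_card_n[of 2 "UNIV :: 'v set"] by auto
      have "card H = 3" using a n_subsets[of "UNIV :: 'v set" 2] by (simp add: choose_two)
      moreover have large: "2 \<le> card C'" if C': "\<forall>e\<in>H. e \<inter> C' \<noteq> {}" for C'
      proof (rule ccontr)
        assume "\<not> 2 \<le> card C'"
        \<comment> \<open>Fewer than two vertices leave two of the three uncovered, and these form
          an edge.\<close>
        then have "2 \<le> card (- C')" using a by (simp add: Compl_eq_Diff_UNIV card_Diff_subset)
        then obtain e where "e \<subseteq> - C'" "card e = 2" using obtain_subset_with_card_n by metis
        then show False using C' a by auto
      qed
      moreover have "e \<inter> C \<noteq> {}" if "e \<in> H" for e
      proof
        assume "e \<inter> C = {}"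
        then have "card (e \<union> C) = 4" using that a C by (subst card_Un_disjoint) auto
        then show False using card_mono[of UNIV "e \<union> C"] a by simp
      qed
      ultimately show ?aci using C by (intro exI[of _ C]) auto
    next
      assume ?b
      then obtain v :: "nat \<Rightarrow> 'v" where v: "bij_betw v {1..t+1} UNIV"
        and Hv: "H = {v ` {1..t}, v ` ({1..t-1} \<union> {t+1})}" by blast
      have inj: "inj_on v {1..t+1}" using v by (simp add: bij_betw_def)
      have "v ` {1..t} \<noteq> v ` ({1..t-1} \<union> {t+1})"
      proof
        assume "v ` {1..t} = v ` ({1..t-1} \<union> {t+1})"
        then have "v (t + 1) \<in> v ` {1..t}" by simp
        then obtain i where "i \<in> {1..t}" "v (t + 1) = v i" by blast
        then show False using inj_onD[OF inj, of "t + 1" i] by simp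
      qed
      then have "card H = 2" by (simp add: Hv)
      \<comment> \<open>\<open>2 \<le> t\<close> puts 1 into both index sets, so a single vertex
        covers both edges.\<close>
      moreover have "e \<inter> {v 1} \<noteq> {}" if "e \<in> H" for e
        using that assms(1,2) by (auto simp: Hv)
      moreover have "1 \<le> card C'" if "\<forall>e\<in>H. e \<inter> C' \<noteq> {}" for C'
      proof -
        have "C' \<noteq> {}" using that by (auto simp: Hv)
        then show ?thesis by (simp add: Suc_le_eq card_gt_0_iff)
      qed
      ultimately show ?aci by (intro exI[of _ "{v 1}"]) auto
    qed
  qed
  finally show ?thesis .
qed

end
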